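(* Let $\mathcal{H}$ be a separable real Hilbert space and let $\rho\colon\mathcal{H}\to(0,\infty)$ be lower semicontinuous, that is, all level sets $\mathcal{H}(t)=\{x\in\mathcal{H}:\rho(x)>t\}$, $t\ge 0$, are open. Then for all $x,w\in\mathcal{H}$ and all $t\in(0,\rho(x))$, $$\mathbb{P}\bigl(\tau_{p_{x,w}^{-1}(\mathcal{H}(t))}<\infty\mid\Theta=0\bigr)=1,$$ i.e. the number of iterations of the shrinkage loop called within elliptical slice sampling is almost surely finite.
   Context: For $x,w\in\mathcal{H}$, $p_{x,w}\colon[0,2\pi)\to\mathcal{H}$, $p_{x,w}(\theta)=\cos(\theta)x+\sin(\theta)w$, with pre-image $p_{x,w}^{-1}(A)=\{\theta\in[0,2\pi):p_{x,w}(\theta)\in A\}$. Generalized intervals: for $\alpha,\beta\in[0,2\pi)$, $I(\alpha,\beta)=[\alpha,\beta)$ if $\alpha<\beta$, $I(\alpha,\beta)=[0,\beta)\cup[\alpha,2\pi)$ if $\alpha>\beta$, $I(\alpha,\alpha)=[0,2\pi)$; and $J(\alpha,\beta)=I(\alpha,\beta)$ if $\alpha\ne\beta$, $J(\alpha,\alpha)=\emptyset$. $\mathcal{U}_I$ denotes the uniform distribution on a bounded Borel set $I\subset\mathbb{R}$ of positive Lebesgue measure, and $\delta_v$ the Dirac measure at $v$. Shrinkage chain: for $\theta\in[0,2\pi)$ let $\Lambda_\theta=\{(\gamma,\gamma^{\min},\gamma^{\max})\in[0,2\pi)^3:\gamma,\theta\in I(\gamma^{\min},\gamma^{\max}),\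 \gamma\ne\theta\}$ and, for $z=(\gamma,\gamma^{\min},\gamma^{\max})\in\Lambda_\theta$ and $D\in\mathcal{B}([0,2\pi)^3)$, $$R_\theta(z,D)=\mathbf{1}_{J(\gamma^{\min},\theta)}(\gamma)\,\bigl(\mathcal{U}_{I(\gamma,\gamma^{\max})}\otimes\delta_{(\gamma,\gamma^{\max})}\bigr)(D)+\mathbf{1}_{I(\theta,\gamma^{\max})}(\gamma)\,\bigl(\mathcal{U}_{I(\gamma^{\min},\gamma)}\otimes\delta_{(\gamma^{\min},\gamma)}\bigr)(D).$$ This is a Markov kernel with $R_\theta(z,\Lambda_\theta)=1$. Let $\mathbb{P}(\cdot\mid\Theta=\theta)$ be the law under which $(Z_n)_{n\in\mathbb{N}}$, $Z_n=(\Gamma_n,\Gamma_n^{\min},\Gamma_n^{\max})$, is the Markov chain with transition kernel $R_\theta$ and initial law $\mathbb{P}_{Z_1}(D)=\int_0^{2\pi}\delta_{(\gamma,\gamma,\gamma)}(D)\frac{\mathrm{d}\gamma}{2\pi}$ (so $Z_1\in\Lambda_\theta$ almost surely). For $S\in\mathcal{B}([0,2\pi))$ let $\tau_S=\inf\{n\in\mathbb{N}:\Gamma_n\in S\}$ ($\inf\emptyset=\infty$). *)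

theory Defs
  imports "HOL-Probability.Probability"
begin

definition level_set :: "('a \<Rightarrow> real) \<Rightarrow> real \<Rightarrow> 'a set" where
  "level_set \<rho> t = {x. \<rho> x > t}"

definition ellipse :: "'a::real_vector \<Rightarrow> 'a \<Rightarrow> real \<Rightarrow> 'a" where
  "ellipse x w \<theta> = cos \<theta> *\<^sub>R x + sin \<theta> *\<^sub>R w"

definition angles :: "real set" where
  "angles = {0..<2 * pi}"

definition ellipse_preimage :: "'a::real_vector \<Rightarrow> 'a \<Rightarrow> 'a set \<Rightarrow> real set" where
  "ellipse_preimage x w A = {\<theta> \<in> angles. ellipse x w \<theta> \<in> A}"

definition gen_I :: "real \<Rightarrow> real \<Rightarrow> real set" where
  "gen_I \<alpha> \<beta> =
     (if \<alpha> < \<beta> then {\<alpha>..<\<beta>}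
      else if \<alpha> > \<beta> then {0..<\<beta>} \<union> {\<alpha>..<2 * pi}
      else {0..<2 * pi})"

definition gen_J :: "real \<Rightarrow> real \<Rightarrow> real set" where
  "gen_J \<alpha> \<beta> = (if \<alpha> \<noteq> \<beta> then gen_I \<alpha> \<beta> else {})"

text \<open>States are triples of the current angle and the lower and upper interval bounds.\<close>

definition state_space :: "(real \<times> real \<times> real) measure" where
  "state_space = restrict_space borel (angles \<times> angles \<times> angles)"

definition admissible :: "real \<Rightarrow> (real \<times> real \<times> real) set" where
  "admissible \<theta> =
     {(g, gmin, gmax). g \<in> angles \<and> gmin \<in> angles \<and> gmax \<in> angles \<and>
        g \<in> gen_I gmin gmax \<and> \<theta> \<in> gen_I gmin gmax \<and> g \<noteq> \<theta>}"

text \<open>The shrinkage kernel is only defined on admissible states; the value 0 elsewhere is a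
  dummy. The chain stays in the admissible states almost surely, so it plays no role.\<close>

definition shrinkage_kernel ::
    "real \<Rightarrow> real \<times> real \<times> real \<Rightarrow> (real \<times> real \<times> real) set \<Rightarrow> real" where
  "shrinkage_kernel \<theta> z D =
     (if z \<in> admissible \<theta> then
        (case z of (g, gmin, gmax) \<Rightarrow>
           indicator (gen_J gmin \<theta>) g *
             measure (uniform_measure lborel (gen_I g gmax) \<Otimes>\<^sub>M return borel (g, gmax)) D +
           indicator (gen_I \<theta> gmax) g *
             measure (uniform_measure lborel (gen_I gmin g) \<Otimes>\<^sub>M return borel (gmin, g)) D)
      else 0)"

definition initial_law :: "(real \<times> real \<times> real) set \<Rightarrow> real" where
  "initial_law D =
     (LINT \<gamma>:{0..<2 * pi}|lborel. measure (return state_space (\<gamma>, \<gamma>, \<gamma>)) D / (2 * pi))"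

text \<open>The \<open>\<sigma>\<close>-algebra generated by \<open>Z 1, \<dots>, Z n\<close>.\<close>

definition history :: "'b measure \<Rightarrow> 's measure \<Rightarrow> (nat \<Rightarrow> 'b \<Rightarrow> 's) \<Rightarrow> nat \<Rightarrow> 'b measure" where
  "history M S Z n =
     vimage_algebra (space M) (\<lambda>\<omega>. \<lambda>i\<in>{1..n}. Z i \<omega>) (Pi\<^sub>M {1..n} (\<lambda>_. S))"

text \<open>Time starts at 1; \<open>Z 0\<close> is unconstrained. The initial law and the transition
  probabilities are given as set functions on the measurable sets of the state space.\<close>

definition markov_chain ::
    "'b measure \<Rightarrow> 's measure \<Rightarrow> ('s set \<Rightarrow> real) \<Rightarrow> ('s \<Rightarrow> 's set \<Rightarrow> real) \<Rightarrow>
     (nat \<Rightarrow> 'b \<Rightarrow> 's) \<Rightarrow> bool" where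
  "markov_chain M S \<mu> K Z \<longleftrightarrow>
     prob_space M \<and>
     (\<forall>n\<ge>1. Z n \<in> measurable M S) \<and>
     (\<forall>D\<in>sets S. measure (distr M S (Z 1)) D = \<mu> D) \<and>
     (\<forall>n\<ge>1. \<forall>D\<in>sets S. AE \<omega> in M.
        real_cond_exp M (history M S Z n) (indicator {\<omega> \<in> space M. Z (Suc n) \<omega> \<in> D}) \<omega>
          = K (Z n \<omega>) D)"

text \<open>\<open>M\<close> carries the conditional law given \<open>\<Theta> = \<theta>\<close> of the shrinkage procedure.\<close>

definition shrinkage_chain ::
    "real \<Rightarrow> 'b measure \<Rightarrow> (nat \<Rightarrow> 'b \<Rightarrow> real \<times> real \<times> real) \<Rightarrow> bool" where
  "shrinkage_chain \<theta> M Z \<longleftrightarrow>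
     markov_chain M state_space initial_law (shrinkage_kernel \<theta>) Z"

definition hitting_time ::
    "(nat \<Rightarrow> 'b \<Rightarrow> real \<times> real \<times> real) \<Rightarrow> real set \<Rightarrow> 'b \<Rightarrow> enat" where
  "hitting_time Z S \<omega> = Inf {enat n | n. n \<ge> 1 \<and> fst (Z n \<omega>) \<in> S}"

end

theory Submission
  imports Defs
begin

text \<open>The level set pulled back to the circle contains \<open>[0, \<epsilon>)\<close> for some \<open>\<epsilon> > 0\<close>, because the
  ellipse passes through \<open>x\<close> at angle \<open>0\<close>. As long as the chain has not entered \<open>[0, \<epsilon>)\<close>, the
  bounds of the current interval are rejected angles, so the next angle is uniform on a set of
  measure at most \<open>2\<pi>\<close> that still contains \<open>[0, \<epsilon>)\<close>. Each step therefore enters \<open>[0, \<epsilon>)\<close> with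
  conditional probability at least \<open>\<epsilon> / 2\<pi>\<close>, and the time of entry has geometric tails.\<close>

section \<open>Product measures and states that wrap around \<open>0\<close>\<close>

text \<open>The Dirac factor reduces \<open>D\<close> to its slice at \<open>y\<close>. Both
  summands of \<open>shrinkage_kernel\<close> have this shape, with \<open>y\<close> the new pair of
  bounds, so they become ratios of interval lengths.\<close>

lemma measure_uniform_pair_return:
  fixes y :: "'c::second_countable_topology" and A :: "real set"
  assumes A: "A \<in> sets borel" "emeasure lborel A \<noteq> 0" "emeasure lborel A \<noteq> \<infinity>"
    and "D \<in> sets borel"
  shows "measure (uniform_measure lborel A \<Otimes>\<^sub>M return borel y) D
    = measure lborel (A \<inter> {g. (g, y) \<in> D}) / measure lborel A"
proof -
  let ?U = "uniform_measure lborel A"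
  have D: "D \<in> sets (borel \<Otimes>\<^sub>M borel)"
    using assms(4) by (simp only: borel_prod)
  interpret R: prob_space "return borel y" by (rule prob_space_return) simp
  have D': "D \<in> sets (?U \<Otimes>\<^sub>M return borel y)"
    using D by (simp cong: sets_pair_measure_cong)
  have slice: "{g. (g, y) \<in> D} \<in> sets borel"
    using sets_Pair2[OF D, of y] by (simp add: vimage_def)
  have "emeasure (?U \<Otimes>\<^sub>M return borel y) D
      = (\<integral>\<^sup>+g. emeasure (return borel y) (Pair g -` D) \<partial>?U)"
    by (rule R.emeasure_pair_measure_alt[OF D'])
  also have "\<dots> = (\<integral>\<^sup>+g. indicator {g. (g, y) \<in> D} g \<partial>?U)"
    by (intro nn_integral_cong) (use sets_Pair1[OF D] in \<open>simp add: indicator_def\<close>)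
  also have "\<dots> = emeasure ?U {g. (g, y) \<in> D}"
    using slice by (subst nn_integral_indicator) simp_all
  finally have "measure (?U \<Otimes>\<^sub>M return borel y) D = measure ?U {g. (g, y) \<in> D}"
    by (simp add: measure_def)
  also have "\<dots> = measure lborel (A \<inter> {g. (g, y) \<in> D}) / measure lborel A"
    using A slice by (subst measure_uniform_measure) simp_all
  finally show ?thesis .
qed

text \<open>At \<open>a = b\<close> the union is already the whole circle, so one formula covers
  both the wrapped intervals and the initial states, whose bounds coincide.\<close>

lemma gen_I_wrap:
  assumes "0 \<le> b" "b \<le> a" "a < 2 * pi"
  shows "gen_I a b = {0..<b} \<union> {a..<2 * pi}"
  using assms by (auto simp: gen_I_def)

lemma sets_state_space_iff:
  "D \<in> sets state_space \<longleftrightarrow> D \<in> sets borel \<and> D \<subseteq> angles \<times> angles \<times> angles"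
proof -
  have "angles \<times> angles \<times> angles \<in> sets (borel :: (real \<times> real \<times> real) measure)"
    by (simp add: borel_prod[symmetric] angles_def)
  then show ?thesis
    by (auto simp: state_space_def sets_restrict_space_iff)
qed

text \<open>The states with angle in \<open>[\<epsilon>, 2\<pi>)\<close> whose interval wraps around \<open>0\<close> and contains \<open>[0, \<epsilon>)\<close>.\<close>

definition missed :: "real \<Rightarrow> (real \<times> real \<times> real) set" where
  "missed e = {(g, a, b). e \<le> g \<and> g < 2 * pi \<and> e \<le> b \<and> b \<le> a \<and> a < 2 * pi \<and> (g < b \<or> a \<le> g)}"

text \<open>The bad states: the angle is still outside \<open>{0..<e}\<close>, yet the invariant
  \<open>missed e\<close> fails. They are shown to have probability zero.\<close>

definition stray :: "real \<Rightarrow> (real \<times> real \<times> real) set" where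
  "stray e = {(g, a, b) \<in> angles \<times> angles \<times> angles. e \<le> g} - missed e"

lemma borel_missed: "missed e \<in> sets borel"
proof -
  have "missed e = {z \<in> space borel. e \<le> fst z \<and> fst z < 2 * pi \<and> e \<le> snd (snd z)
      \<and> snd (snd z) \<le> fst (snd z) \<and> fst (snd z) < 2 * pi
      \<and> (fst z < snd (snd z) \<or> fst (snd z) \<le> fst z)}"
    by (auto simp: missed_def)
  also have "\<dots> \<in> sets borel"
    unfolding borel_prod[symmetric] by measurable
  finally show ?thesis .
qed

lemma missed_sets: "0 < e \<Longrightarrow> missed e \<in> sets state_space"
  unfolding sets_state_space_iff using borel_missed by (auto simp: missed_def angles_def)

lemma stray_sets: "stray e \<in> sets state_space"
proof -
  have "{(g, a, b) \<in> angles \<times> angles \<times> angles. e \<le> g}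
      = ({e..} \<inter> angles) \<times> angles \<times> angles"
    by auto
  also have "\<dots> \<in> sets borel"
    by (simp add: borel_prod[symmetric] angles_def)
  finally show ?thesis
    unfolding sets_state_space_iff stray_def using borel_missed by auto
qed

section \<open>One-step estimates for the kernel and the initial law\<close>

text \<open>The interval has length \<open>b + (2 * pi - a)\<close>, which is at most
  \<open>2 * pi\<close>, and its initial piece of length \<open>e\<close> lies outside
  \<open>missed e\<close>. Every other angle in it satisfies all conditions of
  \<open>missed e\<close>, so the slice of \<open>stray e\<close> is empty.\<close>

lemma uniform_step:
  assumes e: "0 < e" "e \<le> b" "b \<le> a" "a < 2 * pi"
  shows "measure (uniform_measure lborel (gen_I a b) \<Otimes>\<^sub>M return borel (a, b)) (missed e)
      \<le> 1 - e / (2 * pi)" (is ?missed)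
    and "measure (uniform_measure lborel (gen_I a b) \<Otimes>\<^sub>M return borel (a, b)) (stray e) = 0"
      (is ?stray)
proof -
  let ?I = "{0..<b} \<union> {a..<2 * pi}"
  have I: "gen_I a b = ?I"
    using e by (intro gen_I_wrap) auto
  have em: "emeasure lborel ?I = ennreal (b + (2 * pi - a))"
    using e by (subst plus_emeasure[symmetric]) auto
  have m: "measure lborel ?I = b + (2 * pi - a)"
    using em e by (simp add: measure_def)
  have pair: "measure (uniform_measure lborel (gen_I a b) \<Otimes>\<^sub>M return borel (a, b)) D
      = measure lborel (?I \<inter> {g. (g, a, b) \<in> D}) / (b + (2 * pi - a))"
    if "D \<in> sets borel" for D
    unfolding I m[symmetric]
    by (rule measure_uniform_pair_return) (use that em e in auto)
  have "?I \<inter> {g. (g, a, b) \<in> missed e} = {e..<b} \<union> {a..<2 * pi}"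
    using e by (auto simp: missed_def)
  moreover have "emeasure lborel ({e..<b} \<union> {a..<2 * pi}) = ennreal (b - e + (2 * pi - a))"
    using e by (subst plus_emeasure[symmetric]) auto
  ultimately have "measure lborel (?I \<inter> {g. (g, a, b) \<in> missed e}) = b - e + (2 * pi - a)"
    using e by (simp add: measure_def)
  moreover have "(b - e + (2 * pi - a)) / (b + (2 * pi - a)) = 1 - e / (b + (2 * pi - a))"
    using e by (simp add: field_simps)
  moreover have "e / (2 * pi) \<le> e / (b + (2 * pi - a))"
    using e by (intro divide_left_mono) auto
  ultimately show ?missed
    using pair[OF borel_missed] by simp
  have "?I \<inter> {g. (g, a, b) \<in> stray e} = {}"
    using e by (auto simp: missed_def stray_def)
  then show ?stray
    using pair[of "stray e"] stray_sets[of e] by (simp add: sets_state_space_iff)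
qed

text \<open>Since \<open>b \<le> a\<close>, exactly one of the two indicators is active. The
  rejected angle \<open>g\<close> replaces the bound on its own side of \<open>0\<close>, and the
  new bounds again satisfy the hypotheses of \<open>uniform_step\<close>.\<close>

lemma shrinkage_kernel_missed:
  assumes e: "0 < e" and z: "z \<in> missed e"
  shows "shrinkage_kernel 0 z (missed e) \<le> 1 - e / (2 * pi)"
    and "shrinkage_kernel 0 z (stray e) = 0"
proof -
  obtain g a b where zeq: "z = (g, a, b)" by (cases z)
  have *: "e \<le> g" "g < 2 * pi" "e \<le> b" "b \<le> a" "a < 2 * pi" "g < b \<or> a \<le> g"
    using z by (auto simp: missed_def zeq)
  have I: "gen_I a b = {0..<b} \<union> {a..<2 * pi}"
    using * e by (intro gen_I_wrap) auto
  \<comment> \<open>Admissibility selects the genuine kernel formula instead of the dummy value: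
    \<open>g\<close> is nonzero because \<open>e \<le> g\<close>, and \<open>0\<close> lies in the
    interval because \<open>0 < b\<close>.\<close>
  have adm: "z \<in> admissible 0"
    using * e by (auto simp: admissible_def zeq I angles_def)
  have J: "gen_J a 0 = {a..<2 * pi}" and I0: "gen_I 0 b = {0..<b}"
    using * e by (auto simp: gen_J_def gen_I_def)
  have "shrinkage_kernel 0 z D =
      (if a \<le> g then measure (uniform_measure lborel (gen_I g b) \<Otimes>\<^sub>M return borel (g, b)) D
       else measure (uniform_measure lborel (gen_I a g) \<Otimes>\<^sub>M return borel (a, g)) D)" for D
    using adm * e by (auto simp: shrinkage_kernel_def zeq J I0)
  then show "shrinkage_kernel 0 z (missed e) \<le> 1 - e / (2 * pi)"
    and "shrinkage_kernel 0 z (stray e) = 0"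
    using uniform_step[of e b g] uniform_step[of e g a] * e by auto
qed

text \<open>A diagonal state has angle below \<open>e\<close> or belongs to \<open>missed e\<close>,
  so the integrand vanishes.\<close>

lemma initial_law_stray: "0 < e \<Longrightarrow> initial_law (stray e) = 0"
  unfolding initial_law_def
proof (rule trans[OF set_lebesgue_integral_cong[where g = "\<lambda>_. 0"]])
  assume "0 < e"
  then have "(\<gamma>, \<gamma>, \<gamma>) \<notin> stray e" for \<gamma>
    by (auto simp: stray_def missed_def angles_def)
  then show "\<forall>\<gamma>. \<gamma> \<in> {0..<2 * pi} \<longrightarrow>
      measure (return state_space (\<gamma>, \<gamma>, \<gamma>)) (stray e) / (2 * pi) = 0"
    using stray_sets[of e] by (simp add: measure_return)
qed simp_all

section \<open>Histories and conditional probabilities of Markov chains\<close>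

lemma subalgebra_history:
  assumes "\<And>n. n \<ge> 1 \<Longrightarrow> Z n \<in> measurable M S"
  shows "subalgebra M (history M S Z n)"
proof -
  have "(\<lambda>\<omega>. \<lambda>i\<in>{1..n}. Z i \<omega>) \<in> measurable M (Pi\<^sub>M {1..n} (\<lambda>_. S))"
    by (rule measurable_restrict) (use assms in auto)
  then show ?thesis
    unfolding subalgebra_def history_def
    by (simp add: sets_vimage_algebra_space sets_image_in_sets)
qed

lemma history_event:
  assumes Z: "\<And>n. n \<ge> 1 \<Longrightarrow> Z n \<in> measurable M S" and i: "1 \<le> i" "i \<le> n" and D: "D \<in> sets S"
  shows "{\<omega> \<in> space M. Z i \<omega> \<in> D} \<in> sets (history M S Z n)"
proof -
  let ?f = "\<lambda>\<omega>. \<lambda>i\<in>{1..n}. Z i \<omega>"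
  have f: "?f \<in> space M \<rightarrow> space (Pi\<^sub>M {1..n} (\<lambda>_. S))"
    using measurable_space[OF Z] by (auto simp: space_PiM)
  have "(\<lambda>h. h i) -` D \<inter> space (Pi\<^sub>M {1..n} (\<lambda>_. S)) \<in> sets (Pi\<^sub>M {1..n} (\<lambda>_. S))"
    using i D by (intro measurable_sets[OF measurable_component_singleton]) auto
  from in_vimage_algebra[OF this, of ?f "space M"]
  have "?f -` ((\<lambda>h. h i) -` D \<inter> space (Pi\<^sub>M {1..n} (\<lambda>_. S))) \<inter> space M
      \<in> sets (history M S Z n)"
    by (simp add: history_def)
  also have "?f -` ((\<lambda>h. h i) -` D \<inter> space (Pi\<^sub>M {1..n} (\<lambda>_. S))) \<inter> space M
      = {\<omega> \<in> space M. Z i \<omega> \<in> D}"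
    using f i by auto
  finally show ?thesis .
qed

text \<open>Integrating the conditional probability over the past event \<open>B\<close> turns a
  pointwise kernel bound on \<open>B\<close> into a bound on the joint probability. It serves twice:
  for the geometric decay, and with \<open>c = 0\<close> to exclude stray states.\<close>

lemma markov_chain_measure_step:
  assumes chain: "markov_chain M S \<mu> K Z" and n: "1 \<le> n" and D: "D \<in> sets S"
    and B: "B \<in> sets (history M S Z n)"
    and K: "\<And>\<omega>. \<omega> \<in> B \<Longrightarrow> K (Z n \<omega>) D \<le> c"
  shows "measure M (B \<inter> {\<omega> \<in> space M. Z (Suc n) \<omega> \<in> D}) \<le> c * measure M B"
proof -
  interpret prob_space M
    using chain by (simp add: markov_chain_def)
  have Z: "\<And>n. n \<ge> 1 \<Longrightarrow> Z n \<in> measurable M S"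
    using chain by (simp add: markov_chain_def)
  let ?F = "history M S Z n" and ?E = "{\<omega> \<in> space M. Z (Suc n) \<omega> \<in> D}"
  have sub: "subalgebra M ?F" by (rule subalgebra_history[OF Z])
  interpret finite_measure_subalgebra M ?F
    by unfold_locales (rule sub)
  have BM: "B \<in> sets M" using B sub by (auto simp: subalgebra_def)
  have EM: "?E \<in> sets M"
    using measurable_sets[OF Z D, of "Suc n"] by (simp add: vimage_def Int_def conj_commute)
  let ?r = "real_cond_exp M ?F (indicator ?E)"
  have iE: "integrable M (indicator ?E :: _ \<Rightarrow> real)"
    using EM by (simp add: integrable_indicator_iff emeasure_eq_measure)
  have ir: "integrable M ?r" by (rule real_cond_exp_int(1)[OF iE])
  have AEr: "AE \<omega> in M. ?r \<omega> = K (Z n \<omega>) D"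
    using chain n D by (simp add: markov_chain_def)
  have "measure M (B \<inter> ?E) = (\<integral>\<omega>. indicator (B \<inter> ?E) \<omega> \<partial>M)"
    using BM EM by simp
  also have "\<dots> = (\<integral>\<omega>\<in>B. indicator ?E \<omega> \<partial>M)"
    by (simp add: set_lebesgue_integral_def indicator_inter_arith)
  \<comment> \<open>Defining property of conditional expectation, available because \<open>B\<close>
    lies in the history.\<close>
  also have "\<dots> = (\<integral>\<omega>\<in>B. ?r \<omega> \<partial>M)"
    by (rule real_cond_exp_intA[OF iE B])
  also have "\<dots> \<le> (\<integral>\<omega>. c * indicator B \<omega> \<partial>M)"
    unfolding set_lebesgue_integral_def
  proof (rule integral_mono_AE)
    show "integrable M (\<lambda>\<omega>. indicator B \<omega> *\<^sub>R ?r \<omega>)"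
      using integrable_mult_indicator[OF BM ir] .
    show "integrable M (\<lambda>\<omega>. c * indicator B \<omega>)"
      using BM by (simp add: integrable_indicator_iff emeasure_eq_measure)
    show "AE \<omega> in M. indicator B \<omega> *\<^sub>R ?r \<omega> \<le> c * indicator B \<omega>"
      using AEr by eventually_elim (auto simp: K split: split_indicator)
  qed
  also have "\<dots> = c * measure M B" using BM by simp
  finally show ?thesis .
qed

section \<open>Almost sure entry into a neighbourhood of \<open>0\<close>\<close>

text \<open>Almost surely the chain neither starts in \<open>stray e\<close> nor jumps there from
  \<open>missed e\<close>. A path that never gets below \<open>e\<close> therefore stays in
  \<open>missed e\<close> forever, which the geometric tail rules out almost surely.\<close>

lemma shrinkage_chain_AE_enters:
  assumes chain: "shrinkage_chain 0 M Z" and e: "0 < e"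
  shows "AE \<omega> in M. \<exists>n\<ge>1. fst (Z n \<omega>) < e"
proof -
  note mc = chain[unfolded shrinkage_chain_def]
  interpret prob_space M
    using mc by (simp add: markov_chain_def)
  have Z: "\<And>n. n \<ge> 1 \<Longrightarrow> Z n \<in> measurable M state_space"
    using mc by (simp add: markov_chain_def)
  have ev: "{\<omega> \<in> space M. Z n \<omega> \<in> D} \<in> sets M" if "n \<ge> 1" "D \<in> sets state_space" for n D
    using measurable_sets[OF Z that(2), OF that(1)]
    by (simp add: vimage_def Int_def conj_commute)
  \<comment> \<open>The maximum keeps \<open>c\<close> nonnegative even when \<open>e\<close>
    exceeds \<open>2 * pi\<close>.\<close>
  define c where "c = max 0 (1 - e / (2 * pi))"
  have c: "0 \<le> c" "c < 1" using e by (auto simp: c_def)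
  define B where "B n = {\<omega> \<in> space M. \<forall>i\<in>{1..n}. Z i \<omega> \<in> missed e}" for n
  have BF: "B n \<in> sets (history M state_space Z n)" for n
  proof -
    have "space (history M state_space Z n) = space M"
      by (simp add: history_def)
    then have "B n = {\<omega> \<in> space (history M state_space Z n).
        \<forall>i\<in>{1..n}. \<omega> \<in> {\<omega> \<in> space M. Z i \<omega> \<in> missed e}}"
      by (auto simp: B_def)
    also have "\<dots> \<in> sets (history M state_space Z n)"
    proof (rule sets.sets_Collect_finite_All)
      fix i assume "i \<in> {1..n}"
      then have "{\<omega> \<in> space M. Z i \<omega> \<in> missed e} \<in> sets (history M state_space Z n)"
        using e by (intro history_event Z missed_sets) auto
      then show "{\<omega> \<in> space (history M state_space Z n). \<omega> \<in> {\<omega> \<in> space M. Z i \<omega> \<in> missed e}}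
          \<in> sets (history M state_space Z n)"
        by (simp add: \<open>space (history M state_space Z n) = space M\<close> conj_assoc[symmetric])
    qed simp
    finally show ?thesis .
  qed
  have BM: "B n \<in> sets M" for n
    using BF subalgebra_history[of Z M state_space n] Z by (auto simp: subalgebra_def)
  \<comment> \<open>The exponent lags by one: \<open>Z 1\<close> comes from the initial law, so
    \<open>B 1\<close> only gets the trivial bound \<open>1\<close>.\<close>
  have tail: "measure M (B (Suc n)) \<le> c ^ n" for n
  proof (induction n)
    case (Suc n)
    have "B (Suc (Suc n)) = B (Suc n) \<inter> {\<omega> \<in> space M. Z (Suc (Suc n)) \<omega> \<in> missed e}"
      by (auto simp: B_def atLeastAtMostSuc_conv)
    also have "measure M \<dots> \<le> c * measure M (B (Suc n))"
    proof (rule markov_chain_measure_step[OF mc _ missed_sets[OF e] BF])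
      fix \<omega> assume "\<omega> \<in> B (Suc n)"
      then have "Z (Suc n) \<omega> \<in> missed e" by (simp add: B_def)
      from shrinkage_kernel_missed(1)[OF e this]
      show "shrinkage_kernel 0 (Z (Suc n) \<omega>) (missed e) \<le> c" by (simp add: c_def)
    qed simp
    also have "\<dots> \<le> c * c ^ n" using Suc c by (intro mult_left_mono)
    finally show ?case by simp
  qed simp
  have "AE \<omega> in M. \<exists>n. \<omega> \<notin> B n"
  proof -
    have *: "measure M (\<Inter>n. B n) \<le> c ^ n" for n
      by (rule order_trans[OF finite_measure_mono[OF _ BM[of "Suc n"]] tail]) blast
    have "measure M (\<Inter>n. B n) \<le> 0"
      by (rule LIMSEQ_le_const[OF LIMSEQ_realpow_zero[OF c]]) (use * in auto)
    then have "emeasure M (\<Inter>n. B n) = 0"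
      by (simp add: emeasure_eq_measure measure_le_0_iff)
    then have "(\<Inter>n. B n) \<in> null_sets M" using BM by auto
    from AE_not_in[OF this] show ?thesis by simp
  qed
  moreover have "AE \<omega> in M. Z 1 \<omega> \<notin> stray e"
  proof -
    have "measure M {\<omega> \<in> space M. Z 1 \<omega> \<in> stray e} = measure (distr M state_space (Z 1)) (stray e)"
      using stray_sets Z by (subst measure_distr) (auto intro: arg_cong[where f = "measure M"])
    also have "\<dots> = 0"
      using mc stray_sets initial_law_stray[OF e] by (simp add: markov_chain_def)
    finally have "{\<omega> \<in> space M. Z 1 \<omega> \<in> stray e} \<in> null_sets M"
      using ev[of 1, OF _ stray_sets] by (auto simp: emeasure_eq_measure)
    from AE_not_in[OF this] AE_space show ?thesis by eventually_elim simp
  qed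
  moreover have "AE \<omega> in M. \<forall>n\<ge>1. Z n \<omega> \<in> missed e \<longrightarrow> Z (Suc n) \<omega> \<notin> stray e"
    unfolding AE_all_countable
  proof
    fix n
    show "AE \<omega> in M. 1 \<le> n \<longrightarrow> Z n \<omega> \<in> missed e \<longrightarrow> Z (Suc n) \<omega> \<notin> stray e"
    proof (cases "1 \<le> n")
      case True
      let ?C = "{\<omega> \<in> space M. Z n \<omega> \<in> missed e}"
      let ?E = "{\<omega> \<in> space M. Z (Suc n) \<omega> \<in> stray e}"
      have "measure M (?C \<inter> ?E) \<le> 0 * measure M ?C"
        by (rule markov_chain_measure_step[OF mc True stray_sets
              history_event[OF Z True order_refl missed_sets[OF e]]])
          (use shrinkage_kernel_missed(2)[OF e] in auto)
      then have "?C \<inter> ?E \<in> null_sets M"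
        using ev[OF True missed_sets[OF e]] ev[OF _ stray_sets, of "Suc n"]
        by (auto simp: emeasure_eq_measure measure_le_0_iff)
      from AE_not_in[OF this] AE_space show ?thesis by eventually_elim auto
    qed simp
  qed
  ultimately show ?thesis
    using AE_space
  proof eventually_elim
    fix \<omega>
    assume out: "\<exists>n. \<omega> \<notin> B n" and one: "Z 1 \<omega> \<notin> stray e"
      and step: "\<forall>n\<ge>1. Z n \<omega> \<in> missed e \<longrightarrow> Z (Suc n) \<omega> \<notin> stray e"
      and \<omega>: "\<omega> \<in> space M"
    show "\<exists>n\<ge>1. fst (Z n \<omega>) < e"
    proof (rule ccontr)
      assume "\<not> ?thesis"
      then have ge: "e \<le> fst (Z n \<omega>)" if "1 \<le> n" for n using that by force
      \<comment> \<open>Among states with angle at least \<open>e\<close>, \<open>missed e\<close>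
        and \<open>stray e\<close> are complementary.\<close>
      have missed: "Z n \<omega> \<in> missed e" if "1 \<le> n" "Z n \<omega> \<notin> stray e" for n
        using measurable_space[OF Z[OF that(1)] \<omega>] ge[OF that(1)] that(2)
        by (auto simp: stray_def state_space_def space_restrict_space split: prod.splits)
      have "Z n \<omega> \<in> missed e" if "1 \<le> n" for n
        using that
      proof (induction n rule: nat_induct_at_least)
        case base
        show ?case using missed one by simp
      next
        case (Suc n)
        then show ?case using missed[of "Suc n"] step by simp
      qed
      then show False using out \<omega> by (auto simp: B_def)
    qed
  qed
qed

section \<open>Level sets along the ellipse\<close>

lemma continuous_on_ellipse:
  fixes x w :: "'a::real_normed_vector"
  shows "continuous_on A (ellipse x w)"
  unfolding ellipse_def[abs_def] by (intro continuous_intros)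

theorem corollary2p8:
  fixes \<rho> :: "'a::{real_inner, complete_space} \<Rightarrow> real"
    and x w :: 'a and t :: real
    and M :: "'b measure" and Z :: "nat \<Rightarrow> 'b \<Rightarrow> real \<times> real \<times> real"
  assumes "separable_space (euclidean :: 'a topology)"
    and "\<And>y. \<rho> y > 0"
    and "\<And>s. s \<ge> 0 \<Longrightarrow> open (level_set \<rho> s)"
    and "0 < t" and "t < \<rho> x"
    and "shrinkage_chain 0 M Z"
  shows "measure M {\<omega> \<in> space M.
           hitting_time Z (ellipse_preimage x w (level_set \<rho> t)) \<omega> < \<infinity>} = 1"
proof -
  let ?S = "ellipse_preimage x w (level_set \<rho> t)"
  interpret prob_space M
    using assms(6) by (simp add: shrinkage_chain_def markov_chain_def)
  have Z: "\<And>n. n \<ge> 1 \<Longrightarrow> Z n \<in> measurable M state_space"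
    using assms(6) by (simp add: shrinkage_chain_def markov_chain_def)
  \<comment> \<open>Taking the preimage in all of the real line makes it open around
    \<open>0\<close>; intersecting with \<open>angles\<close> keeps the nonnegative half of the
    ball.\<close>
  let ?O = "ellipse x w -` level_set \<rho> t"
  have "open ?O"
    using assms(3)[of t] assms(4) continuous_on_ellipse by (intro open_vimage) auto
  moreover have "0 \<in> ?O"
    using assms(5) by (simp add: ellipse_def level_set_def)
  ultimately obtain e where e: "0 < e" "ball 0 e \<subseteq> ?O"
    by (meson open_contains_ball)
  have S: "?S = angles \<inter> ?O" by (auto simp: ellipse_preimage_def)
  have SB: "?S \<in> sets borel"
    unfolding S angles_def using \<open>open ?O\<close> by auto
  \<comment> \<open>An infimum in \<open>enat\<close> is finite exactly when some member is; the
    empty set yields infinity.\<close>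
  have finite_iff: "hitting_time Z ?S \<omega> < \<infinity> \<longleftrightarrow> (\<exists>n\<ge>1. fst (Z n \<omega>) \<in> ?S)" for \<omega>
    unfolding hitting_time_def Inf_less_iff by force
  have fst_Z: "(\<lambda>\<omega>. fst (Z n \<omega>)) \<in> borel_measurable M" if "n \<ge> 1" for n
  proof -
    have "(fst :: real \<times> real \<times> real \<Rightarrow> real) \<in> borel_measurable state_space"
      unfolding state_space_def borel_prod[symmetric]
      by (intro measurable_restrict_space1) simp
    from measurable_compose[OF Z[OF that] this] show ?thesis .
  qed
  \<comment> \<open>Measurability matters for the value \<open>1\<close>: \<open>measure\<close> is
    \<open>0\<close> by default on nonmeasurable sets, so the almost sure statement needs this event
    to be in \<open>sets M\<close>.\<close>
  have "{\<omega> \<in> space M. hitting_time Z ?S \<omega> < \<infinity>}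
      = (\<Union>n\<in>{1..}. (\<lambda>\<omega>. fst (Z n \<omega>)) -` ?S \<inter> space M)"
    unfolding finite_iff by auto
  also have "\<dots> \<in> sets M"
    using measurable_sets[OF fst_Z SB] by (intro sets.countable_UN') auto
  finally have meas: "{\<omega> \<in> space M. hitting_time Z ?S \<omega> < \<infinity>} \<in> sets M" .
  have "AE \<omega> in M. hitting_time Z ?S \<omega> < \<infinity>"
    using shrinkage_chain_AE_enters[OF assms(6) e(1)] AE_space
  proof eventually_elim
    fix \<omega> assume "\<exists>n\<ge>1. fst (Z n \<omega>) < e" and \<omega>: "\<omega> \<in> space M"
    then obtain n where n: "n \<ge> 1" "fst (Z n \<omega>) < e" by auto
    have "fst (Z n \<omega>) \<in> angles"
      using measurable_space[OF Z[OF n(1)] \<omega>]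
      by (auto simp: state_space_def space_restrict_space)
    moreover from this have "fst (Z n \<omega>) \<in> ball 0 e"
      using n(2) by (simp add: angles_def)
    ultimately have "fst (Z n \<omega>) \<in> ?S"
      using e(2) unfolding S by blast
    then show "hitting_time Z ?S \<omega> < \<infinity>"
      using n(1) unfolding finite_iff by blast
  qed
  then show ?thesis
    using meas by (subst prob_Collect_eq_1) auto
qed

end
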